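(* Let $X$ be an Archimedean vector lattice. The following are equivalent: (i) $X$ has the countable supremum property; (ii) order convergence and $\sigma$-order convergence coincide on $X$, i.e. $\mathrm{o}=\sigma\mathrm{o}$; (iii) order convergence is first countable on $X$; (iv) order convergence is weakly first countable on $X$; (v) order convergence is Fréchet–Urysohn on $X$; (vi) order convergence is sequential on $X$.
   Context: Nets are indexed by pre-ordered upward directed sets. A tail of $(x_\alpha)$ is a set $\{x_\alpha:\alpha\ge\alpha_0\}$. A net $(y_\beta)$ is a quasi-subnet of $(x_\alpha)$ if every tail of $(x_\alpha)$ contains a tail of $(y_\beta)$. A convergence structure on a set specifies for each point $x$ the nets converging to $x$, such that constant nets converge, quasi-subnets of a net converging to $x$ converge to $x$, and if $x_\alpha\to x$, $y_\alpha\to x$ (same index set) and $z_\alpha\in\{x_\alpha,y_\alpha\}$ for all $\alpha$, then $z_\alpha\to x$. The tail filter $[x_\alpha]$ consists of all sets containing a tail of $(x_\alpha)$; a filter $\mathcal F$ converges to $x$ if $\mathcal F=[x_\alpha]$ for some net $x_\alpha\to x$. A convergence structure is: first countable if whenever a filter $\mathcal F\to x$ there is a filter $\mathcal G\subseteq\mathcal F$ with a countable base such that $\mathcal G\to x$; weakly first countable if for every net $x_\alpha\to x$ there is an increasing sequence $(\alpha_n')$ of indices such that $x_{\alpha_n}\to x$ whenever $\alpha_n\ge\alpha_n'$ for every $n$; Fréchet–Urysohn if for every $x$, the range of every net $(x_\alpha)$ converging to $x$ contains a sequence $(x_{\alpha_n})$ converging to $x$; sequential if every sequentially closed set (containing limits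 of its convergent sequences) is closed (contains limits of its convergent nets). Order convergence: $x_\alpha\xrightarrow{\mathrm{o}}x$ if there is a set $D\subseteq X$ with $\bigwedge D=0$ such that for every $d\in D$ there is $\alpha_d$ with $|x_\alpha-x|\le d$ for all $\alpha\ge\alpha_d$. $\sigma$-order convergence: $x_\alpha\xrightarrow{\sigma\mathrm{o}}x$ if there is a sequence $(u_n)$ in $X_+$ with $\bigwedge_n u_n=0$ such that for every $n$ there is $\alpha_n$ with $|x_\alpha-x|\le u_n$ for all $\alpha\ge\alpha_n$. $X$ has the countable supremum property if every $A\subseteq X$ with $\bigwedge A=0$ contains a countable $B\subseteq A$ with $\bigwedge B=0$. *)

theory Defs
  imports
    Complex_Main
    "HOL-Library.Countable_Set"
    "HOL-Library.Lattice_Algebras"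
    "HOL-Library.Lub_Glb"
begin

section \<open>Archimedean vector lattices\<close>

class vector_lattice = ordered_real_vector + lattice_ab_group_add_abs

text \<open>
  The axiom says that \<open>0\<close>, clearly a lower bound, is the infimum of the multiples
  \<open>x / n\<close>, \<open>n \<ge> 1\<close>, of every \<open>x \<ge> 0\<close>.
\<close>

class archimedean_vector_lattice = vector_lattice +
  assumes archimedean: "0 \<le> x \<Longrightarrow> (\<And>n::nat. y \<le> (1 / real (Suc n)) *\<^sub>R x) \<Longrightarrow> y \<le> 0"

instance real :: archimedean_vector_lattice
proof
  fix x y :: real
  assume "\<And>n::nat. y \<le> (1 / real (Suc n)) *\<^sub>R x"
  then have le: "y \<le> inverse (real (Suc n)) * x" for n
    by (simp add: inverse_eq_divide del: of_nat_Suc)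
  have "(\<lambda>n. inverse (real (Suc n)) * x) \<longlonglongrightarrow> 0"
    by (rule tendsto_mult_left_zero[OF LIMSEQ_inverse_real_of_nat])
  then show "y \<le> 0"
    by (rule LIMSEQ_le_const) (use le in blast)
qed

text \<open>
  No completeness is assumed, so \<^const>\<open>Inf\<close> is not available; that the infimum of a set
  \<open>D\<close> exists and is \<open>0\<close> is expressed by \<open>isGlb UNIV D 0\<close>.
\<close>

definition countable_sup_property :: "'a::vector_lattice itself \<Rightarrow> bool" where
  "countable_sup_property _ \<longleftrightarrow>
     (\<forall>A::'a set. isGlb UNIV A 0 \<longrightarrow> (\<exists>B\<subseteq>A. countable B \<and> isGlb UNIV B 0))"


section \<open>Nets\<close>

text \<open>
  A net is a directed preorder \<open>r\<close>, whose index set is \<^term>\<open>Field r\<close> and in which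
  \<open>(a, b) \<in> r\<close> means \<open>a \<le> b\<close>, together with a function \<open>x\<close> whose values
  outside \<^term>\<open>Field r\<close> are irrelevant. Sequences are the nets over \<^const>\<open>natLeq\<close>.
\<close>

definition directed_preorder :: "'i rel \<Rightarrow> bool" where
  "directed_preorder r \<longleftrightarrow> Preorder r \<and> Field r \<noteq> {} \<and>
     (\<forall>a\<in>Field r. \<forall>b\<in>Field r. \<exists>c\<in>Field r. (a, c) \<in> r \<and> (b, c) \<in> r)"

definition tail :: "'i rel \<Rightarrow> ('i \<Rightarrow> 'a) \<Rightarrow> 'i \<Rightarrow> 'a set" where
  "tail r x a = {x b | b. (a, b) \<in> r}"

definition tail_filter :: "'i rel \<Rightarrow> ('i \<Rightarrow> 'a) \<Rightarrow> 'a filter" where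
  "tail_filter r x = (INF a\<in>Field r. principal (tail r x a))"

lemma eventually_tail_filter:
  assumes "directed_preorder r"
  shows "eventually P (tail_filter r x) \<longleftrightarrow> (\<exists>a\<in>Field r. \<forall>y\<in>tail r x a. P y)"
proof -
  have ne: "Field r \<noteq> {}" and "trans r"
    and dir: "\<And>a b. a \<in> Field r \<Longrightarrow> b \<in> Field r \<Longrightarrow> \<exists>c\<in>Field r. (a, c) \<in> r \<and> (b, c) \<in> r"
    using assms by (simp_all add: directed_preorder_def preorder_on_def)
  have mono: "tail r x c \<subseteq> tail r x a" if "(a, c) \<in> r" for a c
    using that transD[OF \<open>trans r\<close>] by (fastforce simp: tail_def)
  have base: "\<exists>c\<in>Field r. principal (tail r x c) \<le> inf (principal (tail r x a)) (principal (tail r x b))"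
    if "a \<in> Field r" "b \<in> Field r" for a b
  proof -
    obtain c where c: "c \<in> Field r" "(a, c) \<in> r" "(b, c) \<in> r"
      using dir \<open>a \<in> Field r\<close> \<open>b \<in> Field r\<close> by metis
    show ?thesis
      by (rule bexI[OF _ c(1)]) (simp add: mono c)
  qed
  have "eventually P (tail_filter r x) \<longleftrightarrow> (\<exists>a\<in>Field r. eventually P (principal (tail r x a)))"
    unfolding tail_filter_def by (rule eventually_INF_base[OF ne base])
  then show ?thesis
    by (simp only: eventually_principal)
qed


section \<open>Convergence structures\<close>

text \<open>
  HOL cannot quantify over all index types inside a formula. A convergence structure is
  therefore represented by its instances at particular index types: the nets range over an
  arbitrary type \<open>'i\<close> of indices (all index sets \<^term>\<open>Field r\<close> in \<open>'i\<close>), and sequences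
  need the separate instance at \<^typ>\<open>nat\<close>. In the definitions below, \<open>conv\<close> and \<open>seq_conv\<close>
  are meant to be these two instances of one and the same polymorphic notion of convergence.

  The theorem is stated for every type \<open>'i\<close> into which \<open>X\<close> embeds; this only excludes index
  types too small to carry the relevant nets on \<open>X\<close>. As \<open>'i\<close> is otherwise arbitrary, nets of
  every size are covered.
\<close>

type_synonym ('i, 'a) net_conv = "'i rel \<Rightarrow> ('i \<Rightarrow> 'a) \<Rightarrow> 'a \<Rightarrow> bool"

definition filter_conv :: "('i, 'a) net_conv \<Rightarrow> 'a filter \<Rightarrow> 'a \<Rightarrow> bool" where
  "filter_conv conv F p \<longleftrightarrow>
     (\<exists>r x. directed_preorder r \<and> F = tail_filter r x \<and> conv r x p)"

definition has_countable_base :: "'a filter \<Rightarrow> bool" where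
  "has_countable_base F \<longleftrightarrow>
     (\<exists>\<B>. countable \<B> \<and> (\<forall>P. eventually P F \<longleftrightarrow> (\<exists>B\<in>\<B>. \<forall>y\<in>B. P y)))"

text \<open>
  The order on the type of filters is reversed inclusion of the families of sets: every set
  of \<open>G\<close> belongs to \<open>F\<close> iff \<open>F \<le> G\<close>.
\<close>

definition first_countable_conv :: "('i, 'a) net_conv \<Rightarrow> bool" where
  "first_countable_conv conv \<longleftrightarrow>
     (\<forall>F p. filter_conv conv F p \<longrightarrow>
        (\<exists>G. F \<le> G \<and> has_countable_base G \<and> filter_conv conv G p))"

definition weakly_first_countable_conv ::
    "('i, 'a) net_conv \<Rightarrow> (nat, 'a) net_conv \<Rightarrow> bool" where
  "weakly_first_countable_conv conv seq_conv \<longleftrightarrow>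
     (\<forall>r x p. directed_preorder r \<and> conv r x p \<longrightarrow>
        (\<exists>a'. range a' \<subseteq> Field r \<and> (\<forall>m n. m \<le> n \<longrightarrow> (a' m, a' n) \<in> r) \<and>
           (\<forall>a. (\<forall>n. (a' n, a n) \<in> r) \<longrightarrow> seq_conv natLeq (\<lambda>n. x (a n)) p)))"

definition frechet_urysohn_conv ::
    "('i, 'a) net_conv \<Rightarrow> (nat, 'a) net_conv \<Rightarrow> bool" where
  "frechet_urysohn_conv conv seq_conv \<longleftrightarrow>
     (\<forall>r x p. directed_preorder r \<and> conv r x p \<longrightarrow>
        (\<exists>a. range a \<subseteq> Field r \<and> seq_conv natLeq (\<lambda>n. x (a n)) p))"

definition closed_conv :: "('i, 'a) net_conv \<Rightarrow> 'a set \<Rightarrow> bool" where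
  "closed_conv conv S \<longleftrightarrow>
     (\<forall>r x p. directed_preorder r \<and> x ` Field r \<subseteq> S \<and> conv r x p \<longrightarrow> p \<in> S)"

definition sequentially_closed_conv :: "(nat, 'a) net_conv \<Rightarrow> 'a set \<Rightarrow> bool" where
  "sequentially_closed_conv seq_conv S \<longleftrightarrow>
     (\<forall>s p. range s \<subseteq> S \<and> seq_conv natLeq s p \<longrightarrow> p \<in> S)"

definition sequential_conv ::
    "('i, 'a) net_conv \<Rightarrow> (nat, 'a) net_conv \<Rightarrow> bool" where
  "sequential_conv conv seq_conv \<longleftrightarrow>
     (\<forall>S. sequentially_closed_conv seq_conv S \<longrightarrow> closed_conv conv S)"


section \<open>Order convergence\<close>

definition order_conv :: "('i, 'a::vector_lattice) net_conv" where
  "order_conv r x p \<longleftrightarrow>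
     (\<exists>D. isGlb UNIV D 0 \<and>
        (\<forall>d\<in>D. \<exists>a\<in>Field r. \<forall>b. (a, b) \<in> r \<longrightarrow> \<bar>x b - p\<bar> \<le> d))"

definition sigma_order_conv :: "('i, 'a::vector_lattice) net_conv" where
  "sigma_order_conv r x p \<longleftrightarrow>
     (\<exists>u::nat \<Rightarrow> 'a. (\<forall>n. 0 \<le> u n) \<and> isGlb UNIV (range u) 0 \<and>
        (\<forall>n. \<exists>a\<in>Field r. \<forall>b. (a, b) \<in> r \<longrightarrow> \<bar>x b - p\<bar> \<le> u n))"

end

theory Submission
  imports Defs
begin

text \<open>
  The properties imply one another in the order (i) to (vi). If \<open>u n\<close> witnesses the
  \<open>\<sigma>\<close>-order convergence of a net to \<open>p\<close>, the order intervals \<open>[p - u n, p + u n]\<close> generate a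
  filter that witnesses first countability. For the return from (vi) to (i), let \<open>0\<close> be the infimum of \<open>A\<close> and let \<open>S\<close>
  be the set of all \<open>s\<close> that dominate every lower bound of some countable subset of \<open>A\<close>.
  Countable unions of countable sets make \<open>S\<close> sequentially closed. On the other hand \<open>S\<close> is
  directed downwards with infimum \<open>0\<close>, so it is a net converging to \<open>0\<close>; hence \<open>0 \<in> S\<close>,
  which says that some countable subset of \<open>A\<close> has infimum \<open>0\<close>.
\<close>

section \<open>Infima and directed preorders in elementary terms\<close>

lemma isGlb_UNIV_iff:
  "isGlb UNIV A z \<longleftrightarrow> (\<forall>a\<in>A. z \<le> a) \<and> (\<forall>w. (\<forall>a\<in>A. w \<le> a) \<longrightarrow> w \<le> z)"
  by (auto simp: isGlb_def greatestP_def isLb_def setle_def setge_def)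

lemma directed_preorderD:
  assumes "directed_preorder r"
  shows directed_preorder_refl: "a \<in> Field r \<Longrightarrow> (a, a) \<in> r"
    and directed_preorder_trans: "(a, b) \<in> r \<Longrightarrow> (b, c) \<in> r \<Longrightarrow> (a, c) \<in> r"
    and directed_preorder_nonempty: "Field r \<noteq> {}"
    and directed_preorder_upper:
      "a \<in> Field r \<Longrightarrow> b \<in> Field r \<Longrightarrow> \<exists>c\<in>Field r. (a, c) \<in> r \<and> (b, c) \<in> r"
  using assms unfolding directed_preorder_def preorder_on_def
  by (auto dest: refl_onD transD)

section \<open>Order convergence against sigma-order convergence\<close>

lemma sigma_order_conv_imp_order_conv: "sigma_order_conv r x p \<Longrightarrow> order_conv r x p"
  unfolding sigma_order_conv_def order_conv_def by blast

text \<open>The dominating set \<open>D\<close> may be thinned out to a countable \<open>B\<close>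
  with the same infimum, and an enumeration of \<open>B\<close> is the required sequence.\<close>

lemma order_conv_imp_sigma_order_conv:
  fixes x :: "'i \<Rightarrow> 'a::vector_lattice"
  assumes csp: "countable_sup_property TYPE('a)" and "order_conv r x p"
    and "directed_preorder r"
  shows "sigma_order_conv r x p"
proof -
  obtain D where D: "isGlb UNIV D 0"
    and le: "\<And>d. d \<in> D \<Longrightarrow> \<exists>a\<in>Field r. \<forall>b. (a, b) \<in> r \<longrightarrow> \<bar>x b - p\<bar> \<le> d"
    using assms(2) unfolding order_conv_def by blast
  obtain B where B: "B \<subseteq> D" "countable B" "isGlb UNIV B 0"
    using csp D unfolding countable_sup_property_def by blast
  show ?thesis
  \<comment> \<open>Only a nonempty set is the range of a sequence. If the empty set has infimum
    \<open>0\<close>, every vector is \<open>\<le> 0\<close>, so the space is trivial and the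
    constant sequence \<open>0\<close> serves.\<close>
  proof (cases "B = {}")
    case True
    then have "w \<le> (0::'a)" for w
      using B(3) by (simp add: isGlb_UNIV_iff)
    then have [simp]: "w = (0::'a)" for w
      using neg_le_0_iff_le[of w] by (simp add: order_antisym)
    obtain a where "a \<in> Field r"
      using directed_preorder_nonempty[OF assms(3)] by blast
    then show ?thesis
      unfolding sigma_order_conv_def
      by (intro exI[of _ "\<lambda>_. 0"]) (auto simp: isGlb_UNIV_iff)
  next
    case False
    then have range: "range (from_nat_into B) = B"
      using B(2) by (rule range_from_nat_into)
    then have mem: "from_nat_into B n \<in> B" for n
      by blast
    then have "0 \<le> from_nat_into B n" for n
      using B(3) by (simp add: isGlb_UNIV_iff)
    moreover have "from_nat_into B n \<in> D" for n
      using mem B(1) by blast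
    ultimately show ?thesis
      using le B(3) unfolding sigma_order_conv_def
      by (intro exI[of _ "from_nat_into B"]) (simp add: range)
  qed
qed

section \<open>Nets realising a countable filter base\<close>

text \<open>A nonzero vector spans a copy of the real line, so the space is infinite, and an
  infinite set absorbs a product with \<open>nat\<close>. This makes room for pairs of a number and
  a point in any index type into which the space embeds.\<close>

lemma ex_inj_Times_nat:
  includes cardinal_syntax
  assumes "(a::'a::real_vector) \<noteq> 0"
  shows "\<exists>h :: nat \<times> 'a \<Rightarrow> 'a. inj h"
proof -
  have "inj (\<lambda>t::real. t *\<^sub>R a)"
    using assms by (simp add: inj_def)
  then have "infinite (range (\<lambda>t::real. t *\<^sub>R a))"
    using infinite_UNIV_char_0 finite_imageD by blast
  then have inf: "infinite (UNIV :: 'a set)"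
    using finite_subset[OF subset_UNIV] by metis
  then have "|UNIV :: nat set| \<le>o |UNIV :: 'a set|"
    by (simp add: infinite_iff_card_of_nat)
  then have "|(UNIV :: nat set) \<times> (UNIV :: 'a set)| =o |UNIV :: 'a set|"
    using card_of_Times_infinite[OF inf UNIV_not_empty] by blast
  then have "|(UNIV :: nat set) \<times> (UNIV :: 'a set)| \<le>o |UNIV :: 'a set|"
    by (rule ordIso_imp_ordLeq)
  then show ?thesis
    unfolding card_of_ordLeq[symmetric] by auto
qed

text \<open>
  Points \<open>y\<close> alone, ordered by the least \<open>n\<close> with \<open>y \<notin> B n\<close>, would not do as indices: a point of
  \<open>\<Inter>n. B n\<close> would be a largest index.
\<close>

lemma net_of_decreasing_base:
  fixes h :: "nat \<times> 'a \<Rightarrow> 'i" and B :: "nat \<Rightarrow> 'a set"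
  assumes h: "inj h" and ne: "\<And>n. B n \<noteq> {}" and dec: "decseq B"
  obtains r :: "'i rel" and x where "directed_preorder r"
    "\<forall>a\<in>Field r. \<exists>n. tail r x a = B n" "\<forall>n. \<exists>a\<in>Field r. tail r x a = B n"
proof -
  \<comment> \<open>Only the numbers are compared. Indices of the same level \<open>n\<close> lie
    below each other, so this is a preorder and not a partial order, and each point of
    \<open>B n\<close> occurs beyond every index of level \<open>n\<close>.\<close>
  define r where "r = {(h (m, y), h (n, z)) |m n y z. m \<le> n \<and> y \<in> B m \<and> z \<in> B n}"
  have mem: "(h (m, y), h (n, z)) \<in> r \<longleftrightarrow> m \<le> n \<and> y \<in> B m \<and> z \<in> B n" for m n y z
    using h by (auto simp: r_def inj_eq)
  have field: "Field r = {h (n, y) |n y. y \<in> B n}"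
  proof
    show "Field r \<subseteq> {h (n, y) |n y. y \<in> B n}"
      by (auto simp: r_def Field_def)
    have "h (n, y) \<in> Field r" if "y \<in> B n" for n y
      by (rule FieldI1[of _ "h (n, y)"]) (simp add: mem that)
    then show "{h (n, y) |n y. y \<in> B n} \<subseteq> Field r"
      by blast
  qed
  have dirpre: "directed_preorder r"
    unfolding directed_preorder_def preorder_on_def
  proof (intro conjI ballI)
    show "r \<subseteq> Field r \<times> Field r"
      by (auto simp: Field_def)
    show "refl_on (Field r) r"
      by (auto simp: refl_on_def field mem)
    show "trans r"
    proof (rule transI)
      fix a b c assume "(a, b) \<in> r" "(b, c) \<in> r"
      then show "(a, c) \<in> r"
        using h by (fastforce simp: r_def inj_eq)
    qed
    show "Field r \<noteq> {}"
      using ne[of 0] by (auto simp: field)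
    fix a b assume "a \<in> Field r" "b \<in> Field r"
    then obtain m y n z where "a = h (m, y)" "y \<in> B m" "b = h (n, z)" "z \<in> B n"
      unfolding field by blast
    moreover obtain w where "w \<in> B (max m n)"
      using ne by blast
    ultimately show "\<exists>c\<in>Field r. (a, c) \<in> r \<and> (b, c) \<in> r"
      by (intro bexI[of _ "h (max m n, w)"]) (auto simp: mem field)
  qed
  \<comment> \<open>The net reads off the point coded by an index. The tail from level
    \<open>n\<close> is the union of all \<open>B k\<close> with \<open>k \<ge> n\<close>, which
    collapses to \<open>B n\<close> because \<open>B\<close> is decreasing.\<close>
  have tail: "tail r (\<lambda>i. snd (inv h i)) (h (n, y)) = B n" if "y \<in> B n" for n y
  proof
    show "tail r (\<lambda>i. snd (inv h i)) (h (n, y)) \<subseteq> B n"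
      using h dec by (fastforce simp: tail_def r_def inj_eq decseq_def)
    show "B n \<subseteq> tail r (\<lambda>i. snd (inv h i)) (h (n, y))"
    proof
      fix z assume "z \<in> B n"
      then have "(h (n, y), h (n, z)) \<in> r"
        using that by (simp add: mem)
      moreover have "z = snd (inv h (h (n, z)))"
        using h by simp
      ultimately show "z \<in> tail r (\<lambda>i. snd (inv h i)) (h (n, y))"
        unfolding tail_def by blast
    qed
  qed
  show thesis
  proof (rule that[OF dirpre], intro ballI)
    fix a assume "a \<in> Field r"
    then show "\<exists>n. tail r (\<lambda>i. snd (inv h i)) a = B n"
      using tail by (auto simp: field)
  next
    have "\<exists>a\<in>Field r. tail r (\<lambda>i. snd (inv h i)) a = B n" for n
    proof -
      obtain y where "y \<in> B n"
        using ne by blast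
      then show ?thesis
        using tail by (intro bexI[of _ "h (n, y)"]) (auto simp: field)
    qed
    then show "\<forall>n. \<exists>a\<in>Field r. tail r (\<lambda>i. snd (inv h i)) a = B n" ..
  qed
qed

section \<open>First countability from sigma-order convergence\<close>

text \<open>Convergence of a filter asks for a net over the same index type \<open>'i\<close>. The
  filter of the order intervals must therefore be realised as a tail filter there, and
  \<open>e\<close> provides the space for it.\<close>

lemma first_countable_order_conv:
  fixes e :: "'a::vector_lattice \<Rightarrow> 'i"
  assumes e: "inj e"
    and eq: "\<And>(r :: 'i rel) (x :: 'i \<Rightarrow> 'a) p.
      directed_preorder r \<Longrightarrow> order_conv r x p \<Longrightarrow> sigma_order_conv r x p"
  shows "first_countable_conv (order_conv :: ('i, 'a) net_conv)"
  unfolding first_countable_conv_def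
proof (intro allI impI)
  fix F :: "'a filter" and p
  assume conv: "filter_conv (order_conv :: ('i, 'a) net_conv) F p"
  then obtain r :: "'i rel" and x
    where r: "directed_preorder r" and F: "F = tail_filter r x" and "order_conv r x p"
    unfolding filter_conv_def by blast
  then obtain u :: "nat \<Rightarrow> 'a" where u0: "\<And>n. 0 \<le> u n" and inf: "isGlb UNIV (range u) 0"
    and le: "\<And>n. \<exists>a\<in>Field r. \<forall>b. (a, b) \<in> r \<longrightarrow> \<bar>x b - p\<bar> \<le> u n"
    using eq unfolding sigma_order_conv_def by blast
  show "\<exists>G. F \<le> G \<and> has_countable_base G \<and> filter_conv (order_conv :: ('i, 'a) net_conv) G p"
  \<comment> \<open>In the trivial space \<open>nat \<times> 'a\<close> does not embed into
    \<open>'a\<close>, but there \<open>F\<close> itself has the base \<open>{UNIV}\<close>.\<close>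
  proof (cases "\<exists>a::'a. a \<noteq> 0")
    case False
    then have triv: "y = 0" for y :: 'a
      by blast
    have "tail r x a = UNIV" if "a \<in> Field r" for a
      using directed_preorder_refl[OF r that] triv by (auto simp: tail_def) metis
    then have "\<forall>P. eventually P F \<longleftrightarrow> (\<exists>B\<in>{UNIV}. \<forall>y\<in>B. P y)"
      using directed_preorder_nonempty[OF r] by (auto simp: F eventually_tail_filter[OF r])
    then have "has_countable_base F"
      unfolding has_countable_base_def by (intro exI[of _ "{UNIV}"]) simp
    then show ?thesis
      using conv by blast
  next
    case True
    then obtain g :: "nat \<times> 'a \<Rightarrow> 'a" where "inj g"
      using ex_inj_Times_nat by blast
    then have h: "inj (e \<circ> g)"
      using e by (simp add: inj_compose)
    \<comment> \<open>The sequence \<open>u\<close> need not decrease; intersecting the first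
      intervals makes the sets decreasing. They contain \<open>p\<close> because every
      \<open>u k\<close> is positive.\<close>
    define B where "B n = {y. \<forall>k\<le>n. \<bar>y - p\<bar> \<le> u k}" for n
    have "p \<in> B n" for n
      by (simp add: B_def u0)
    then have ne: "B n \<noteq> {}" for n
      by blast
    have dec: "decseq B"
      by (auto simp: decseq_def B_def)
    obtain r' :: "'i rel" and x' where r': "directed_preorder r'"
      and tail: "\<forall>a\<in>Field r'. \<exists>n. tail r' x' a = B n"
      and base: "\<forall>n. \<exists>a\<in>Field r'. tail r' x' a = B n"
      by (rule net_of_decreasing_base[OF h ne dec])
    define G where "G = tail_filter r' x'"
    have ev: "eventually P G \<longleftrightarrow> (\<exists>n. \<forall>y\<in>B n. P y)" for P
      unfolding G_def eventually_tail_filter[OF r'] using tail base by metis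
    have "eventually (\<lambda>y. \<bar>y - p\<bar> \<le> u k) F" for k
      using le[of k] unfolding F eventually_tail_filter[OF r] by (fastforce simp: tail_def)
    then have "eventually (\<lambda>y. \<forall>k\<in>{..n}. \<bar>y - p\<bar> \<le> u k) F" for n
      by (simp add: eventually_ball_finite)
    then have "eventually (\<lambda>y. y \<in> B n) F" for n
      by (simp add: B_def Ball_def)
    then have "F \<le> G"
      unfolding le_filter_def ev by (metis (mono_tags, lifting) eventually_mono)
    moreover have "has_countable_base G"
      unfolding has_countable_base_def ev by (intro exI[of _ "range B"]) simp
    moreover have "order_conv r' x' p"
      unfolding order_conv_def
    \<comment> \<open>The same \<open>u\<close> witnesses the convergence of the new net, since its
      tail \<open>B n\<close> lies in the interval of radius \<open>u n\<close> around
      \<open>p\<close>.\<close>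
    proof (intro exI[of _ "range u"] conjI inf ballI)
      fix d assume "d \<in> range u"
      then obtain n where d: "d = u n"
        by blast
      obtain a where a: "a \<in> Field r'" "tail r' x' a = B n"
        using base by blast
      then have "\<bar>x' b - p\<bar> \<le> d" if "(a, b) \<in> r'" for b
        using that by (auto simp: tail_def B_def d)
      then show "\<exists>a\<in>Field r'. \<forall>b. (a, b) \<in> r' \<longrightarrow> \<bar>x' b - p\<bar> \<le> d"
        using a(1) by blast
    qed
    ultimately show ?thesis
      using r' unfolding filter_conv_def G_def by blast
  qed
qed

section \<open>From first countability to sequentiality\<close>

text \<open>Dependent choice: the next index is an upper bound of the previous one and of an index
  from which the next property holds. By transitivity it inherits that property.\<close>

lemma ex_increasing_indices:
  fixes P :: "nat \<Rightarrow> 'a \<Rightarrow> bool"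
  assumes r: "directed_preorder r" and P: "\<And>n. \<exists>a\<in>Field r. \<forall>b. (a, b) \<in> r \<longrightarrow> P n (x b)"
  shows "\<exists>a. range a \<subseteq> Field r \<and> (\<forall>m n. m \<le> n \<longrightarrow> (a m, a n) \<in> r) \<and>
    (\<forall>n b. (a n, b) \<in> r \<longrightarrow> P n (x b))"
proof -
  let ?Q = "\<lambda>n a. a \<in> Field r \<and> (\<forall>b. (a, b) \<in> r \<longrightarrow> P n (x b))"
  have "\<exists>a. \<forall>n. ?Q n (a n) \<and> (a n, a (Suc n)) \<in> r"
  proof (rule dependent_nat_choice)
    show "\<exists>a. ?Q 0 a"
      using P[of 0] by blast
    fix a n assume "?Q n a"
    moreover obtain c where "?Q (Suc n) c"
      using P[of "Suc n"] by blast
    ultimately show "\<exists>b. ?Q (Suc n) b \<and> (a, b) \<in> r"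
      using directed_preorder_upper[OF r, of a c] directed_preorder_trans[OF r] by blast
  qed
  then obtain a where a: "\<And>n. ?Q n (a n)" and step: "\<And>n. (a n, a (Suc n)) \<in> r"
    by blast
  have "(a m, a n) \<in> r" if "m \<le> n" for m n
    using that
  proof (induction rule: dec_induct)
    case base
    show ?case
      using a directed_preorder_refl[OF r] by blast
  next
    case (step k)
    then show ?case
      using \<open>\<And>n. (a n, a (Suc n)) \<in> r\<close> directed_preorder_trans[OF r] by blast
  qed
  then show ?thesis
    using a by blast
qed

text \<open>Choose \<open>a' n\<close> so that the net stays in the \<open>n\<close>-th base set of
  \<open>G\<close> from there on. The set \<open>D\<close> that dominates a net with tail filter
  \<open>G\<close> then dominates every sequence chosen beyond the \<open>a' n\<close>, because each
  of its intervals around \<open>p\<close> contains a base set.\<close>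

lemma first_countable_imp_weakly_first_countable:
  assumes "first_countable_conv (order_conv :: ('i, 'a::vector_lattice) net_conv)"
  shows "weakly_first_countable_conv (order_conv :: ('i, 'a) net_conv) order_conv"
  unfolding weakly_first_countable_conv_def
proof (intro allI impI)
  fix r :: "'i rel" and x :: "'i \<Rightarrow> 'a" and p
  assume "directed_preorder r \<and> order_conv r x p"
  then have r: "directed_preorder r" and "filter_conv (order_conv :: ('i, 'a) net_conv) (tail_filter r x) p"
    unfolding filter_conv_def by blast+
  then obtain G where G: "tail_filter r x \<le> G" "has_countable_base G"
    "filter_conv (order_conv :: ('i, 'a) net_conv) G p"
    using assms unfolding first_countable_conv_def by blast
  obtain \<B> where count: "countable \<B>"
    and ev: "\<And>P. eventually P G \<longleftrightarrow> (\<exists>B\<in>\<B>. \<forall>y\<in>B. P y)"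
    using G(2) unfolding has_countable_base_def by blast
  have "\<B> \<noteq> {}"
    using ev[of "\<lambda>_. True"] by auto
  then have range: "range (from_nat_into \<B>) = \<B>"
    using count by (rule range_from_nat_into)
  obtain r' :: "'i rel" and x' where r': "directed_preorder r'"
    and Gr': "G = tail_filter r' x'" and "order_conv r' x' p"
    using G(3) unfolding filter_conv_def by blast
  then obtain D where D: "isGlb UNIV D 0"
    and le: "\<And>d. d \<in> D \<Longrightarrow> \<exists>a\<in>Field r'. \<forall>b. (a, b) \<in> r' \<longrightarrow> \<bar>x' b - p\<bar> \<le> d"
    unfolding order_conv_def by blast
  have evD: "eventually (\<lambda>y. \<bar>y - p\<bar> \<le> d) G" if "d \<in> D" for d
    using le[OF that] unfolding Gr' eventually_tail_filter[OF r'] by (fastforce simp: tail_def)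
  have "\<exists>a\<in>Field r. \<forall>b. (a, b) \<in> r \<longrightarrow> x b \<in> from_nat_into \<B> n" for n
  proof -
    \<comment> \<open>A base set belongs to \<open>G\<close>, as \<open>ev\<close> shows for
      membership in that set, and hence to the finer tail filter of \<open>x\<close>.\<close>
    have "eventually (\<lambda>y. y \<in> from_nat_into \<B> n) G"
      using range ev by blast
    then have "eventually (\<lambda>y. y \<in> from_nat_into \<B> n) (tail_filter r x)"
      using G(1) by (simp add: le_filter_def)
    then show ?thesis
      unfolding eventually_tail_filter[OF r] tail_def by blast
  qed
  from ex_increasing_indices[OF r, of "\<lambda>n y. y \<in> from_nat_into \<B> n", OF this]
  obtain a' where a': "range a' \<subseteq> Field r" "\<And>m n. m \<le> n \<Longrightarrow> (a' m, a' n) \<in> r"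
    and tail: "\<And>n b. (a' n, b) \<in> r \<Longrightarrow> x b \<in> from_nat_into \<B> n"
    by blast
  have "order_conv natLeq (\<lambda>n. x (a n)) p" if a: "\<And>n. (a' n, a n) \<in> r" for a
    unfolding order_conv_def
  proof (intro exI[of _ D] conjI D ballI)
    fix d assume "d \<in> D"
    then obtain n where n: "\<And>y. y \<in> from_nat_into \<B> n \<Longrightarrow> \<bar>y - p\<bar> \<le> d"
      using evD ev range by (metis (mono_tags, lifting) imageE)
    \<comment> \<open>The index \<open>a m\<close> lies beyond \<open>a' m\<close>, which lies
      beyond \<open>a' n\<close>, so \<open>x (a m)\<close> is in the \<open>n\<close>-th base
      set.\<close>
    have "\<bar>x (a m) - p\<bar> \<le> d" if "n \<le> m" for m
      by (rule n, rule tail, rule directed_preorder_trans[OF r a'(2)[OF that] a])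
    then show "\<exists>n\<in>Field natLeq. \<forall>m. (n, m) \<in> natLeq \<longrightarrow> \<bar>x (a m) - p\<bar> \<le> d"
      by (intro bexI[of _ n]) (auto simp: natLeq_def Field_def)
  qed
  then show "\<exists>a'. range a' \<subseteq> Field r \<and> (\<forall>m n. m \<le> n \<longrightarrow> (a' m, a' n) \<in> r) \<and>
      (\<forall>a. (\<forall>n. (a' n, a n) \<in> r) \<longrightarrow> order_conv natLeq (\<lambda>n. x (a n)) p)"
    using a' by blast
qed

lemma weakly_first_countable_imp_frechet_urysohn:
  assumes "weakly_first_countable_conv conv seq_conv"
  shows "frechet_urysohn_conv conv seq_conv"
  unfolding frechet_urysohn_conv_def
proof (intro allI impI)
  fix r x p assume net: "directed_preorder r \<and> conv r x p"
  then obtain a where a: "range a \<subseteq> Field r" "\<And>m n. m \<le> n \<Longrightarrow> (a m, a n) \<in> r"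
    and "\<And>b. (\<And>n. (a n, b n) \<in> r) \<Longrightarrow> seq_conv natLeq (\<lambda>n. x (b n)) p"
    using assms unfolding weakly_first_countable_conv_def by blast
  \<comment> \<open>The sequence \<open>a\<close> may be taken for \<open>b\<close>: monotonicity
    with \<open>m = n\<close> puts each \<open>a n\<close> below itself.\<close>
  then have "seq_conv natLeq (\<lambda>n. x (a n)) p"
    by simp
  then show "\<exists>a. range a \<subseteq> Field r \<and> seq_conv natLeq (\<lambda>n. x (a n)) p"
    using a(1) by blast
qed

lemma frechet_urysohn_imp_sequential:
  assumes "frechet_urysohn_conv conv seq_conv"
  shows "sequential_conv conv seq_conv"
  unfolding sequential_conv_def closed_conv_def
proof (intro allI impI)
  fix S r x p
  assume S: "sequentially_closed_conv seq_conv S"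
    and net: "directed_preorder r \<and> x ` Field r \<subseteq> S \<and> conv r x p"
  then obtain a where a: "range a \<subseteq> Field r" "seq_conv natLeq (\<lambda>n. x (a n)) p"
    using assms[unfolded frechet_urysohn_conv_def, rule_format, of r x p] by blast
  then have "range (\<lambda>n. x (a n)) \<subseteq> S"
    using net by blast
  then show "p \<in> S"
    using S a(2) unfolding sequentially_closed_conv_def by blast
qed

section \<open>From sequentiality back to the countable supremum property\<close>

text \<open>For each dominating \<open>d\<close>, some term of the net gives
  \<open>z - p \<le> x a - p \<le> d\<close>, so \<open>z - p\<close> is a lower bound of a set with
  infimum \<open>0\<close>. Reflexivity ensures that the index found for \<open>d\<close> is itself
  among those it controls.\<close>

lemma order_conv_ge:
  assumes conv: "order_conv r x p" and r: "\<And>a. a \<in> Field r \<Longrightarrow> (a, a) \<in> r"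
    and ge: "\<And>a. a \<in> Field r \<Longrightarrow> z \<le> x a"
  shows "z \<le> p"
proof -
  obtain D where D: "isGlb UNIV D 0"
    and le: "\<And>d. d \<in> D \<Longrightarrow> \<exists>a\<in>Field r. \<forall>b. (a, b) \<in> r \<longrightarrow> \<bar>x b - p\<bar> \<le> d"
    using conv unfolding order_conv_def by blast
  have "z - p \<le> d" if d: "d \<in> D" for d
  proof -
    obtain a where a: "a \<in> Field r" "\<bar>x a - p\<bar> \<le> d"
      using le[OF d] r by blast
    have "z - p \<le> x a - p"
      using ge[OF a(1)] by (simp add: diff_right_mono)
    also have "\<dots> \<le> \<bar>x a - p\<bar>"
      by (rule abs_ge_self)
    finally show ?thesis
      using a(2) by (rule order_trans)
  qed
  then have "z - p \<le> 0"
    using D unfolding isGlb_UNIV_iff by blast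
  then show ?thesis
    by simp
qed

text \<open>The set \<open>S\<close>, carried into \<open>'i\<close> by \<open>e\<close> and ordered
  downwards, indexes itself. It also serves as its own dominating set, since a member
  \<open>y\<close> beyond \<open>d\<close> satisfies \<open>0 \<le> y \<le> d\<close>.\<close>

lemma order_conv_decreasing_net:
  fixes e :: "'a::vector_lattice \<Rightarrow> 'i" and S :: "'a set"
  assumes e: "inj e" and ne: "S \<noteq> {}" and inf: "isGlb UNIV S 0"
    and dir: "\<And>x y. x \<in> S \<Longrightarrow> y \<in> S \<Longrightarrow> \<exists>z\<in>S. z \<le> x \<and> z \<le> y"
  shows "\<exists>(r :: 'i rel) x. directed_preorder r \<and> x ` Field r \<subseteq> S \<and> order_conv r x 0"
proof -
  define r where "r = {(e x, e y) |x y. x \<in> S \<and> y \<in> S \<and> y \<le> x}"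
  have field: "Field r = e ` S"
    by (auto simp: r_def Field_def)
  have mem: "(e x, e y) \<in> r \<longleftrightarrow> x \<in> S \<and> y \<in> S \<and> y \<le> x" for x y
    using e by (auto simp: r_def inj_eq)
  have "directed_preorder r"
    unfolding directed_preorder_def preorder_on_def
  proof (intro conjI)
    show "r \<subseteq> Field r \<times> Field r"
      by (auto simp: Field_def)
    show "refl_on (Field r) r"
      by (auto simp: refl_on_def field mem)
    show "trans r"
    proof (rule transI)
      fix a b c assume "(a, b) \<in> r" "(b, c) \<in> r"
      then show "(a, c) \<in> r"
        using e by (fastforce simp: r_def inj_eq)
    qed
    show "Field r \<noteq> {}"
      using ne by (simp add: field)
    show "\<forall>a\<in>Field r. \<forall>b\<in>Field r. \<exists>c\<in>Field r. (a, c) \<in> r \<and> (b, c) \<in> r"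
      using dir by (simp add: field mem)
  qed
  moreover have "inv e ` Field r \<subseteq> S"
    using e by (auto simp: field)
  moreover have "order_conv r (inv e) 0"
    unfolding order_conv_def
  proof (intro exI[of _ S] conjI inf ballI)
    fix d assume "d \<in> S"
    moreover have "\<bar>inv e b - 0\<bar> \<le> d" if "(e d, b) \<in> r" for b
    proof -
      obtain y where y: "b = e y" "y \<in> S" "y \<le> d"
        using \<open>(e d, b) \<in> r\<close> e by (auto simp: r_def inj_eq)
      moreover have "0 \<le> y"
        using inf \<open>y \<in> S\<close> by (simp add: isGlb_UNIV_iff)
      ultimately show ?thesis
        using e by simp
    qed
    ultimately show "\<exists>a\<in>Field r. \<forall>b. (a, b) \<in> r \<longrightarrow> \<bar>inv e b - 0\<bar> \<le> d"
      unfolding field by blast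
  qed
  ultimately show ?thesis
    by blast
qed

lemma sequential_imp_countable_sup_property:
  fixes e :: "'a::vector_lattice \<Rightarrow> 'i"
  assumes e: "inj e" and seq: "sequential_conv (order_conv :: ('i, 'a) net_conv) order_conv"
  shows "countable_sup_property TYPE('a)"
  unfolding countable_sup_property_def
proof (intro allI impI)
  fix A :: "'a set"
  assume A: "isGlb UNIV A 0"
  \<comment> \<open>Without completeness a countable subset of \<open>A\<close> may have no infimum,
    so domination of all its lower bounds replaces lying above the infimum.\<close>
  define S where
    "S = {s. \<exists>B\<subseteq>A. countable B \<and> (\<forall>w. (\<forall>b\<in>B. w \<le> b) \<longrightarrow> w \<le> s)}"
  have SI: "s \<in> S"
    if "B \<subseteq> A" "countable B" "\<forall>w. (\<forall>b\<in>B. w \<le> b) \<longrightarrow> w \<le> s" for s B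
    using that unfolding S_def by blast
  have SE: "\<exists>B\<subseteq>A. countable B \<and> (\<forall>w. (\<forall>b\<in>B. w \<le> b) \<longrightarrow> w \<le> s)" if "s \<in> S" for s
    using that unfolding S_def by blast
  have AS: "A \<subseteq> S"
  proof
    fix a assume "a \<in> A"
    then show "a \<in> S"
      by (intro SI[of "{a}"]) auto
  qed
  \<comment> \<open>\<open>0\<close> is a lower bound of \<open>A\<close>, hence of each of its
    subsets, and so is dominated by \<open>s\<close>.\<close>
  have "0 \<le> s" if "s \<in> S" for s
    using SE[OF that] A unfolding isGlb_UNIV_iff by blast
  then have inf: "isGlb UNIV S 0"
    using A AS unfolding isGlb_UNIV_iff by blast
  have "inf s t \<in> S" if "s \<in> S" "t \<in> S" for s t
  proof -
    obtain B where B: "B \<subseteq> A" "countable B" "\<forall>w. (\<forall>b\<in>B. w \<le> b) \<longrightarrow> w \<le> s"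
      using SE[OF \<open>s \<in> S\<close>] by blast
    obtain C where C: "C \<subseteq> A" "countable C" "\<forall>w. (\<forall>b\<in>C. w \<le> b) \<longrightarrow> w \<le> t"
      using SE[OF \<open>t \<in> S\<close>] by blast
    \<comment> \<open>A lower bound of \<open>B \<union> C\<close> is one of both sets, hence below
      \<open>s\<close> and below \<open>t\<close>.\<close>
    show ?thesis
      using B C by (intro SI[of "B \<union> C"]) auto
  qed
  then have dir: "\<exists>z\<in>S. z \<le> s \<and> z \<le> t" if "s \<in> S" "t \<in> S" for s t
    using that by (meson inf_le1 inf_le2)
  have "sequentially_closed_conv order_conv S"
    unfolding sequentially_closed_conv_def
  proof (intro allI impI)
    fix s p assume s: "range s \<subseteq> S \<and> order_conv natLeq s p"
    then have "\<forall>n. \<exists>B\<subseteq>A. countable B \<and> (\<forall>w. (\<forall>b\<in>B. w \<le> b) \<longrightarrow> w \<le> s n)"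
      using SE by blast
    then obtain B where B: "\<And>n. B n \<subseteq> A" "\<And>n. countable (B n)"
      "\<And>n w. (\<forall>b\<in>B n. w \<le> b) \<Longrightarrow> w \<le> s n"
      by metis
    show "p \<in> S"
    \<comment> \<open>A lower bound of the union lies below every \<open>s n\<close>, and lower
      bounds pass to the order limit \<open>p\<close>.\<close>
    proof (intro SI[of "\<Union>n. B n"] allI impI)
      show "(\<Union>n. B n) \<subseteq> A" "countable (\<Union>n. B n)"
        using B by auto
      fix w assume w: "\<forall>b\<in>(\<Union>n. B n). w \<le> b"
      have "w \<le> s n" for n
        by (rule B(3)) (use w in blast)
      then show "w \<le> p"
        using s by (intro order_conv_ge[of natLeq s p w]) (auto simp: natLeq_def)
    qed
  qed
  then have closed: "closed_conv (order_conv :: ('i, 'a) net_conv) S"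
    using seq unfolding sequential_conv_def by blast
  show "\<exists>B\<subseteq>A. countable B \<and> isGlb UNIV B 0"
  \<comment> \<open>A net needs a nonempty index set; an empty \<open>A\<close> is its own countable
    subset with infimum \<open>0\<close>.\<close>
  proof (cases "A = {}")
    case True
    then show ?thesis
      using A by auto
  next
    case False
    then have "S \<noteq> {}"
      using AS by blast
    then obtain r :: "'i rel" and x where "directed_preorder r" "x ` Field r \<subseteq> S" "order_conv r x 0"
      using order_conv_decreasing_net[OF e _ inf dir] by blast
    then have "0 \<in> S"
      using closed unfolding closed_conv_def by blast
    from SE[OF this] obtain B
      where B: "B \<subseteq> A" "countable B" and "\<forall>w. (\<forall>b\<in>B. w \<le> b) \<longrightarrow> w \<le> 0"
      by blast
    moreover have "\<forall>b\<in>B. 0 \<le> b"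
      using A B(1) by (auto simp: isGlb_UNIV_iff)
    ultimately show ?thesis
      by (intro exI[of _ B]) (simp add: isGlb_UNIV_iff)
  qed
qed

section \<open>The equivalence of the six properties\<close>

theorem proposition4p2:
  fixes e :: "'a::archimedean_vector_lattice \<Rightarrow> 'i"
  assumes "inj e"
  shows
    "(countable_sup_property TYPE('a) \<longleftrightarrow>
        (\<forall>(r :: 'i rel) (x :: 'i \<Rightarrow> 'a) p. directed_preorder r \<longrightarrow>
           (order_conv r x p \<longleftrightarrow> sigma_order_conv r x p))) \<and>
     (countable_sup_property TYPE('a) \<longleftrightarrow>
        first_countable_conv (order_conv :: ('i, 'a) net_conv)) \<and>
     (countable_sup_property TYPE('a) \<longleftrightarrow>
        weakly_first_countable_conv (order_conv :: ('i, 'a) net_conv) order_conv) \<and>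
     (countable_sup_property TYPE('a) \<longleftrightarrow>
        frechet_urysohn_conv (order_conv :: ('i, 'a) net_conv) order_conv) \<and>
     (countable_sup_property TYPE('a) \<longleftrightarrow>
        sequential_conv (order_conv :: ('i, 'a) net_conv) order_conv)"
  (is "(?i \<longleftrightarrow> ?ii) \<and> (?i \<longleftrightarrow> ?iii) \<and> (?i \<longleftrightarrow> ?iv) \<and> (?i \<longleftrightarrow> ?v) \<and> (?i \<longleftrightarrow> ?vi)")
proof -
  \<comment> \<open>Purely propositional: a closed chain of six implications makes each property
    equivalent to the first.\<close>
  have cycle: "(i \<longleftrightarrow> ii) \<and> (i \<longleftrightarrow> iii) \<and> (i \<longleftrightarrow> iv) \<and> (i \<longleftrightarrow> v) \<and> (i \<longleftrightarrow> vi)"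
    if "i \<Longrightarrow> ii" "ii \<Longrightarrow> iii" "iii \<Longrightarrow> iv" "iv \<Longrightarrow> v" "v \<Longrightarrow> vi" "vi \<Longrightarrow> i"
    for i ii iii iv v vi
    using that by argo
  show ?thesis
  proof (rule cycle)
    show "?i \<Longrightarrow> ?ii"
      by (intro allI impI iffI)
        (erule (2) order_conv_imp_sigma_order_conv, erule sigma_order_conv_imp_order_conv)
    show ?iii if eq: ?ii
      by (rule first_countable_order_conv[OF assms]) (rule eq[rule_format, THEN iffD1])
    show "?iii \<Longrightarrow> ?iv"
      by (rule first_countable_imp_weakly_first_countable)
    show "?iv \<Longrightarrow> ?v"
      by (rule weakly_first_countable_imp_frechet_urysohn)
    show "?v \<Longrightarrow> ?vi"
      by (rule frechet_urysohn_imp_sequential)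
    show "?vi \<Longrightarrow> ?i"
      by (rule sequential_imp_countable_sup_property[OF assms])
  qed
qed

end
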